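(* Let $p$ be a prime number, let $F$ be the field with $p$ elements, and let $V$ be an $F$-vector space of finite dimension $n>0$. If $\alpha,\beta\in\mathrm{GL}(V)$, then the groups $\mathrm{Hol}(V,\langle\alpha\rangle)=V\rtimes\langle\alpha\rangle$ and $\mathrm{Hol}(V,\langle\beta\rangle)=V\rtimes\langle\beta\rangle$ are isomorphic if and only if the cyclic subgroups $\langle\alpha\rangle$ and $\langle\beta\rangle$ are conjugate in $\mathrm{GL}(V)$.
   Context: For a group $G$ and a subgroup $H$ of $\mathrm{Aut}(G)$, the relative holomorph $\mathrm{Hol}(G,H)=G\rtimes H$ is the semidirect product in which $h g h^{-1}=h(g)$ for $h\in H$, $g\in G$. Here it is applied to the additive group of $V$, with $\mathrm{GL}(V)=\mathrm{Aut}(V)$. *)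

theory Defs
  imports
    "HOL.Vector_Spaces"
    "HOL-Algebra.Bij"
    "HOL-Algebra.Generated_Groups"
    "HOL-Computational_Algebra.Primes"
begin

text \<open>
  Automorphisms are taken from the library's \<^const>\<open>AutoGroup\<close>, hence are extensional functions,
  and products in \<^const>\<open>AutoGroup\<close> are composition of maps (right factor first).
  The pair \<open>(g, h)\<close> stands for the product \<open>g h\<close>, so that the
  multiplication below is forced by \<open>h g h\<inverse> = h(g)\<close>.
\<close>

definition rel_hol :: "('a, 'm) monoid_scheme \<Rightarrow> ('a \<Rightarrow> 'a) set \<Rightarrow> ('a \<times> ('a \<Rightarrow> 'a)) monoid" where
  "rel_hol G H =
    \<lparr>carrier = carrier G \<times> H,
     monoid.mult = (\<lambda>(g, h) (g', h'). (g \<otimes>\<^bsub>G\<^esub> h g', h \<otimes>\<^bsub>AutoGroup G\<^esub> h')),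
     one = (\<one>\<^bsub>G\<^esub>, \<one>\<^bsub>AutoGroup G\<^esub>)\<rparr>"

definition additive_group :: "'v::ab_group_add monoid" where
  "additive_group = \<lparr>carrier = UNIV, monoid.mult = (+), one = 0\<rparr>"

definition general_linear_group :: "('f::field \<Rightarrow> 'v::ab_group_add \<Rightarrow> 'v) \<Rightarrow> ('v \<Rightarrow> 'v) monoid" where
  "general_linear_group scale =
    BijGroup UNIV \<lparr>carrier := {f. Vector_Spaces.linear scale scale f \<and> bij f}\<rparr>"

lemma group_rel_hol:
  assumes G: "group G" and H: "subgroup H (AutoGroup G)"
  shows "group (rel_hol G H)"
proof -
  interpret G: group G by fact
  interpret A: group "AutoGroup G" by (rule G.AutoGroup)
  interpret H: subgroup H "AutoGroup G" by fact
  have aut: "h \<in> hom G G" "h \<in> Bij (carrier G)" if "h \<in> H" for h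
    using H.subset that by (auto simp: AutoGroup_def auto_def)
  have clo: "h x \<in> carrier G" if "h \<in> H" "x \<in> carrier G" for h x
    using aut(1)[OF that(1)] that(2) by (auto simp: hom_def)
  have mul: "h (x \<otimes>\<^bsub>G\<^esub> y) = h x \<otimes>\<^bsub>G\<^esub> h y"
    if "h \<in> H" "x \<in> carrier G" "y \<in> carrier G" for h x y
    using aut(1)[OF that(1)] that(2,3) by (auto simp: hom_def)
  have app: "(h \<otimes>\<^bsub>AutoGroup G\<^esub> k) x = h (k x)"
    if "h \<in> H" "k \<in> H" "x \<in> carrier G" for h k x
    using aut(2)[OF that(1)] aut(2)[OF that(2)] that(3)
    by (simp add: AutoGroup_def BijGroup_def compose_def)
  have one: "\<one>\<^bsub>AutoGroup G\<^esub> x = x" if "x \<in> carrier G" for x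
    using that by (simp add: AutoGroup_def BijGroup_def)
  have oneh: "h \<one>\<^bsub>G\<^esub> = \<one>\<^bsub>G\<^esub>" if "h \<in> H" for h
    using hom_one[OF aut(1)[OF that] G G] .
  have inH: "h \<in> carrier (AutoGroup G)" if "h \<in> H" for h
    using H.subset that by blast
  show ?thesis
  proof (rule groupI)
    fix x assume "x \<in> carrier (rel_hol G H)"
    then obtain g h where x: "x = (g, h)" "g \<in> carrier G" "h \<in> H"
      by (auto simp: rel_hol_def)
    define k where "k = inv\<^bsub>AutoGroup G\<^esub> h"
    have k: "k \<in> H" "k \<otimes>\<^bsub>AutoGroup G\<^esub> h = \<one>\<^bsub>AutoGroup G\<^esub>"
      using x(3) inH by (auto simp: k_def A.l_inv)
    show "\<exists>y\<in>carrier (rel_hol G H). y \<otimes>\<^bsub>rel_hol G H\<^esub> x = \<one>\<^bsub>rel_hol G H\<^esub>"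
      by (rule bexI[of _ "(inv\<^bsub>G\<^esub> (k g), k)"])
         (use x k clo in \<open>auto simp: rel_hol_def\<close>)
  qed (auto simp: rel_hol_def clo mul app one oneh inH G.m_assoc A.m_assoc)
qed

lemma rel_hol_conjugation:
  assumes "group G" "subgroup H (AutoGroup G)" "g \<in> carrier G" "h \<in> H"
  shows "(\<one>\<^bsub>G\<^esub>, h) \<otimes>\<^bsub>rel_hol G H\<^esub> (g, \<one>\<^bsub>AutoGroup G\<^esub>) \<otimes>\<^bsub>rel_hol G H\<^esub> inv\<^bsub>rel_hol G H\<^esub> (\<one>\<^bsub>G\<^esub>, h)
         = (h g, \<one>\<^bsub>AutoGroup G\<^esub>)"
proof -
  interpret G: group G by fact
  interpret A: group "AutoGroup G" by (rule G.AutoGroup)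
  interpret H: subgroup H "AutoGroup G" by fact
  interpret R: group "rel_hol G H" using assms(1,2) by (rule group_rel_hol)
  have h: "h \<in> carrier (AutoGroup G)" using H.subset assms(4) by blast
  then have hg: "h g \<in> carrier G"
    using assms(3) by (auto simp: AutoGroup_def auto_def hom_def)
  have "(\<one>\<^bsub>G\<^esub>, h) \<otimes>\<^bsub>rel_hol G H\<^esub> (g, \<one>\<^bsub>AutoGroup G\<^esub>)
        = (h g, \<one>\<^bsub>AutoGroup G\<^esub>) \<otimes>\<^bsub>rel_hol G H\<^esub> (\<one>\<^bsub>G\<^esub>, h)"
    using assms h hg by (simp add: rel_hol_def) (simp add: AutoGroup_def BijGroup_def)
  moreover have "(\<one>\<^bsub>G\<^esub>, h) \<in> carrier (rel_hol G H)" "(h g, \<one>\<^bsub>AutoGroup G\<^esub>) \<in> carrier (rel_hol G H)"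
    using assms hg by (auto simp: rel_hol_def)
  ultimately show ?thesis by (simp add: R.m_assoc)
qed

lemma group_additive_group: "group (additive_group :: 'v::ab_group_add monoid)"
  by (rule groupI) (auto simp: additive_group_def add.assoc intro: exI[of _ "- x" for x])

lemma mult_general_linear_group:
  assumes "f \<in> carrier (general_linear_group scale)" "g \<in> carrier (general_linear_group scale)"
  shows "f \<otimes>\<^bsub>general_linear_group scale\<^esub> g = f \<circ> g"
  using assms
  by (auto simp: general_linear_group_def BijGroup_def Bij_def extensional_def compose_def)

lemma one_general_linear_group: "\<one>\<^bsub>general_linear_group scale\<^esub> = id"
  by (auto simp: general_linear_group_def BijGroup_def)

lemma group_general_linear_group:
  assumes "vector_space scale"
  shows "group (general_linear_group scale)"
proof -
  interpret vector_space scale by fact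
  let ?L = "general_linear_group scale"
  have c: "f \<in> carrier ?L \<longleftrightarrow> Vector_Spaces.linear scale scale f \<and> bij f" for f
    by (simp add: general_linear_group_def)
  have id_in: "id \<in> carrier ?L"
    by (simp add: c linear_id)
  have comp: "f \<circ> g \<in> carrier ?L" if "f \<in> carrier ?L" "g \<in> carrier ?L" for f g
    using that by (auto simp: c bij_comp intro: Vector_Spaces.linear_compose)
  have iv: "inv_into UNIV f \<in> carrier ?L" if f: "f \<in> carrier ?L" for f
  proof -
    interpret f: Vector_Spaces.linear scale scale f using f c by blast
    have b: "bij f" using f c by blast
    have s: "f (inv_into UNIV f x) = x" for x
      using b by (simp add: bij_is_surj surj_f_inv_f)
    have i: "inv_into UNIV f (f x) = x" for x
      using b by (simp add: bij_is_inj)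
    have "inv_into UNIV f (x + y) = inv_into UNIV f x + inv_into UNIV f y" for x y
      by (metis f.add s i)
    moreover have "inv_into UNIV f (scale r x) = scale r (inv_into UNIV f x)" for r x
      by (metis f.scale s i)
    ultimately have "Vector_Spaces.linear scale scale (inv_into UNIV f)"
      using assms by (simp add: Vector_Spaces.linear_iff)
    with b show ?thesis by (simp add: c bij_imp_bij_inv)
  qed
  show ?thesis
  proof (rule groupI)
    show "\<one>\<^bsub>?L\<^esub> \<in> carrier ?L" using id_in by (simp add: one_general_linear_group)
    fix f assume f: "f \<in> carrier ?L"
    show "\<exists>g\<in>carrier ?L. g \<otimes>\<^bsub>?L\<^esub> f = \<one>\<^bsub>?L\<^esub>"
      using f iv[OF f] c
      by (intro bexI[of _ "inv_into UNIV f"])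
         (auto simp: mult_general_linear_group one_general_linear_group bij_is_inj)
  qed (simp_all add: mult_general_linear_group comp id_in one_general_linear_group o_assoc)
qed

lemma subgroup_general_linear_group:
  assumes "vector_space scale" "subgroup H (general_linear_group scale)"
  shows "subgroup H (AutoGroup additive_group)"
proof -
  have sub: "carrier (general_linear_group scale) \<subseteq> carrier (AutoGroup additive_group)"
    by (auto simp: general_linear_group_def AutoGroup_def auto_def hom_def additive_group_def
        Bij_def extensional_def Vector_Spaces.linear_iff)
  interpret L: group "general_linear_group scale"
    using assms(1) by (rule group_general_linear_group)
  interpret A: group "AutoGroup (additive_group :: 'b monoid)"
    by (rule group.AutoGroup[OF group_additive_group])
  have eq: "general_linear_group scale
      = AutoGroup additive_group \<lparr>carrier := carrier (general_linear_group scale)\<rparr>"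
    by (simp add: general_linear_group_def AutoGroup_def additive_group_def)
  then have "subgroup (carrier (general_linear_group scale)) (AutoGroup additive_group)"
    using sub A.group_incl_imp_subgroup L.is_group by metis
  then show ?thesis
    using A.incl_subgroup assms(2) eq by metis
qed

end

theory Submission
  imports Defs "HOL-Number_Theory.Residues"
begin

text \<open>
  Let \<open>\<phi>\<close> be an isomorphism between the two holomorphs and let \<open>U = {x \<in> V. \<phi> x \<in> V}\<close>. If \<open>U = V\<close>, then
  \<open>\<phi>\<close> restricts to the conjugating map. Otherwise \<open>V/U\<close> embeds into the cyclic group \<open>\<langle>\<beta>\<rangle>\<close>, so \<open>U\<close> is a
  hyperplane, and so is \<open>U' = \<phi>(U)\<close>. With \<open>m = |\<langle>\<alpha>\<rangle>|\<close> and \<open>M = m/p\<close>, the maps \<open>\<alpha>\<close> and \<open>\<beta>\<close> act trivially on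
  \<open>V/U\<close> and \<open>V/U'\<close>, \<open>\<alpha>\<^sup>M\<close> is trivial on \<open>U\<close> but not on \<open>V\<close> (likewise for \<open>\<beta>\<close>), and \<open>\<phi>\<close> intertwines
  \<open>\<alpha>\<close> on \<open>U\<close> with a power of \<open>\<beta>\<close> on \<open>U'\<close>, which may be taken to be a generator of \<open>\<langle>\<beta>\<rangle>\<close>.

  Such an intertwiner \<open>\<theta> : U \<rightarrow> U'\<close> yields one from \<open>V\<close> to \<open>V\<close>: extend \<open>\<theta>\<close> by mapping a vector
  \<open>v\<close> outside \<open>U\<close> to a vector \<open>w\<close> outside \<open>U'\<close> and add, for a functional \<open>L\<close> and \<open>z \<in> U'\<close>, the correction
  \<open>f y = (\<Sum>i<M. L (\<alpha>\<^sup>M\<^sup>-\<^sup>1\<^sup>-\<^sup>i y) \<beta>\<^sup>i z)\<close>, for which the commutator \<open>f \<alpha> - \<beta> f\<close> telescopes to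
  \<open>y \<mapsto> L (\<alpha>\<^sup>M y - y) z\<close>. Choosing \<open>v\<close> and \<open>w\<close> fixed by \<open>\<alpha>\<^sup>q\<close> and \<open>\<beta>\<^sup>q\<close> for a power \<open>q\<close> of \<open>p\<close> makes \<open>\<alpha>\<close>
  unipotent on the kernel of the corrected map, so injectivity need only be tested on fixed vectors.
\<close>

section \<open>Linear algebra over the field with p elements\<close>

lemma funpow_linear:
  assumes "Vector_Spaces.linear scale scale f"
  shows "Vector_Spaces.linear scale scale (f ^^ k)"
proof (induction k)
  case 0
  interpret f: Vector_Spaces.linear scale scale f by fact
  show ?case by (simp add: f.vs1.linear_ident id_def)
next
  case (Suc k)
  show ?case using Vector_Spaces.linear_compose[OF Suc assms] by (simp add: comp_def)
qed

lemma funpow_mult_fixed: "(f ^^ m) x = x \<Longrightarrow> (f ^^ (m * k)) x = x"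
  by (induction k) (auto simp: funpow_add)

text \<open>Finiteness of the space stands in for finite dimension: it makes injective endomorphisms
  bijective and the general linear group finite.\<close>

locale prime_field_space = vector_space scale
  for scale :: "'f::field \<Rightarrow> 'v::ab_group_add \<Rightarrow> 'v" +
  fixes p :: nat
  assumes prime_p: "prime p"
    and card_field: "card (UNIV :: 'f set) = p"
    and finite_space: "finite (UNIV :: 'v set)"
begin

lemma CHAR_field: "CHAR('f) = p"
proof -
  have "CHAR('f) dvd p" using CHAR_dvd_CARD[where ?'a='f] card_field by simp
  moreover have "CHAR('f) \<noteq> 1" by simp
  ultimately show ?thesis using prime_p by (metis prime_nat_iff)
qed

lemma of_nat_eq_0: "(of_nat k :: 'f) = 0 \<longleftrightarrow> p dvd k"
  using of_nat_eq_0_iff_char_dvd[where ?'a='f] CHAR_field by simp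

text \<open>In characteristic p the naturals below p give p distinct elements, which fill the field.
  Scaling is therefore repeated addition, so additivity alone will yield linearity.\<close>

lemma field_elem_of_nat:
  fixes c :: 'f
  obtains k where "c = of_nat k"
proof -
  have fin: "finite (UNIV :: 'f set)"
    using card_field prime_p by (metis card.infinite not_prime_0)
  have "inj_on (of_nat :: nat \<Rightarrow> 'f) {..<p}"
    by (rule inj_onI) (simp add: of_nat_eq_iff_cong_CHAR CHAR_field cong_less_modulus_unique_nat)
  then have "card ((of_nat :: nat \<Rightarrow> 'f) ` {..<p}) = p" by (simp add: card_image)
  then have "(of_nat :: nat \<Rightarrow> 'f) ` {..<p} = UNIV"
    using card_field fin by (metis card_subset_eq subset_UNIV)
  then show ?thesis using that by (metis UNIV_I imageE)
qed

text \<open>Stated relative to \<open>U\<close> because the map \<open>\<theta>\<close> coming from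
  an isomorphism of holomorphs is in general additive only on a hyperplane.\<close>

lemma additive_on_scale:
  assumes "subspace U" "\<And>x y. x \<in> U \<Longrightarrow> y \<in> U \<Longrightarrow> f (x + y) = f x + f y" "x \<in> U"
  shows "f (scale c x) = scale c (f x)"
proof -
  obtain k where k: "c = of_nat k" by (rule field_elem_of_nat)
  have "f 0 = 0" using assms(2)[of 0 0] subspace_0[OF assms(1)] by simp
  then have "f (scale (of_nat k) x) = scale (of_nat k) (f x)" for k
    by (induction k) (simp_all add: scale_left_distrib assms subspace_scale)
  then show ?thesis using k by simp
qed

lemma additive_imp_linear:
  assumes "\<And>x y. f (x + y) = f x + f y"
  shows "Vector_Spaces.linear scale scale f"
  using additive_on_scale[of UNIV f] assms vector_space_axioms by (simp add: Vector_Spaces.linear_iff)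

lemma subspace_if_add_closed:
  assumes "0 \<in> U" "\<And>x y. x \<in> U \<Longrightarrow> y \<in> U \<Longrightarrow> x + y \<in> U"
  shows "subspace U"
proof (rule subspaceI)
  fix c :: 'f and x assume x: "x \<in> U"
  obtain k where k: "c = of_nat k" by (rule field_elem_of_nat)
  have "scale (of_nat k) x \<in> U" for k
    by (induction k) (simp_all add: scale_left_distrib assms x)
  then show "scale c x \<in> U" using k by simp
qed (use assms in auto)

lemma scale_p: "scale (of_nat p) x = 0"
  using of_nat_eq_0[of p] by simp

section \<open>Powers of \<open>1 + D\<close> in characteristic p, and fixed vectors\<close>

lemma funpow_id_plus:
  assumes "Vector_Spaces.linear scale scale D"
  shows "((\<lambda>x. x + D x) ^^ n) y = (\<Sum>i\<le>n. scale (of_nat (n choose i)) ((D ^^ i) y))"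
proof (induction n)
  case (Suc n)
  interpret D: Vector_Spaces.linear scale scale D by fact
  let ?t = "\<lambda>n i. scale (of_nat (n choose i)) ((D ^^ i) y)"
  have "(\<Sum>i\<le>Suc n. ?t (Suc n) i) = y + (\<Sum>i\<le>n. ?t (Suc n) (Suc i))"
    by (simp add: sum.atMost_Suc_shift del: sum.atMost_Suc)
  \<comment> \<open>Pascal's rule splits each coefficient, and linearity pulls one \<open>D\<close>
    out of the first half.\<close>
  also have "(\<Sum>i\<le>n. ?t (Suc n) (Suc i)) = (\<Sum>i\<le>n. D (?t n i)) + (\<Sum>i\<le>n. ?t n (Suc i))"
    by (simp add: scale_left_distrib sum.distrib D.scale)
  also have "y + ((\<Sum>i\<le>n. D (?t n i)) + (\<Sum>i\<le>n. ?t n (Suc i))) = D (\<Sum>i\<le>n. ?t n i) + (\<Sum>i\<le>Suc n. ?t n i)"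
    by (simp add: sum.atMost_Suc_shift D.sum del: sum.atMost_Suc)
  also have "(\<Sum>i\<le>Suc n. ?t n i) = (\<Sum>i\<le>n. ?t n i)"
    by (simp add: binomial_eq_0)
  finally show ?case using Suc by (simp add: add.commute)
qed simp

text \<open>The binomial coefficients strictly between the ends of row p are divisible by p and
  vanish as scalars.\<close>

lemma funpow_p_id_plus:
  assumes "Vector_Spaces.linear scale scale D"
  shows "(\<lambda>x. x + D x) ^^ p = (\<lambda>x. x + (D ^^ p) x)"
proof
  fix y
  have p: "p > 0" using prime_p prime_gt_0_nat by blast
  have z: "scale (of_nat (p choose i)) ((D ^^ i) y) = 0" if "i \<in> {..p} - {0,p}" for i
  proof -
    have "p dvd (p choose i)" using that prime_p by (intro dvd_choose_prime) auto
    then show ?thesis using of_nat_eq_0 by simp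
  qed
  have "((\<lambda>x. x + D x) ^^ p) y = (\<Sum>i\<in>{0,p}. scale (of_nat (p choose i)) ((D ^^ i) y))"
    unfolding funpow_id_plus[OF assms] by (rule sum.mono_neutral_right) (use z in auto)
  then show "((\<lambda>x. x + D x) ^^ p) y = y + (D ^^ p) y" using p by simp
qed

lemma funpow_p_power_id_plus:
  assumes "Vector_Spaces.linear scale scale D"
  shows "(\<lambda>x. x + D x) ^^ (p ^ t) = (\<lambda>x. x + (D ^^ (p ^ t)) x)"
proof (induction t)
  case (Suc t)
  have "(\<lambda>x. x + D x) ^^ (p ^ Suc t) = ((\<lambda>x. x + D x) ^^ (p ^ t)) ^^ p"
    by (simp only: funpow_mult power_Suc mult.commute)
  also have "\<dots> = (\<lambda>x. x + ((D ^^ (p ^ t)) ^^ p) x)"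
    unfolding Suc by (rule funpow_p_id_plus) (rule funpow_linear[OF assms])
  finally show ?case by (simp only: funpow_mult power_Suc mult.commute)
qed simp

text \<open>For \<open>D = f - 1\<close>, the map \<open>D ^^ (p ^ t)\<close> equals
  \<open>f ^^ (p ^ t) - 1\<close> and so kills \<open>y\<close>. The last nonzero vector among the
  iterates of \<open>D\<close> at \<open>y\<close> is killed by \<open>D\<close>, that is, fixed by
  \<open>f\<close>, and it stays in \<open>K\<close>.\<close>

lemma fixed_vector_of_p_power_order:
  assumes "Vector_Spaces.linear scale scale f"
    and "\<And>x. x \<in> K \<Longrightarrow> f x - x \<in> K"
    and "y \<in> K" "y \<noteq> 0" "(f ^^ (p ^ t)) y = y"
  obtains x where "x \<in> K" "x \<noteq> 0" "f x = x"
proof -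
  define D where "D x = f x - x" for x
  interpret f: Vector_Spaces.linear scale scale f by fact
  have "Vector_Spaces.linear scale scale D"
    by (rule additive_imp_linear) (simp add: D_def f.add)
  from funpow_p_power_id_plus[OF this] have "(D ^^ (p ^ t)) y = 0"
    using assms(5) by (simp add: D_def fun_eq_iff)
  then have ex: "\<exists>n. (D ^^ n) y = 0" by blast
  define n where "n = (LEAST n. (D ^^ n) y = 0)"
  have n: "(D ^^ n) y = 0" unfolding n_def using ex by (rule LeastI_ex)
  then obtain k where k: "n = Suc k" using assms(4) by (cases n) auto
  have "(D ^^ k) y \<noteq> 0" using not_less_Least[of k "\<lambda>n. (D ^^ n) y = 0"] k n_def by simp
  moreover have "(D ^^ k) y \<in> K"
    by (induction k) (use assms in \<open>auto simp: D_def\<close>)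
  moreover have "f ((D ^^ k) y) = (D ^^ k) y" using n k by (simp add: D_def)
  ultimately show ?thesis using that by blast
qed

text \<open>Averaging: the sum of \<open>x\<close> over \<open>s\<close> iterates of
  \<open>f ^^ q\<close> is fixed by \<open>f ^^ q\<close>. Modulo \<open>U\<close>, where
  \<open>f\<close> acts trivially, it equals \<open>s\<close> times \<open>x\<close>, and
  \<open>s\<close> is invertible in the field.\<close>

lemma fixed_vector_outside_subspace:
  assumes "Vector_Spaces.linear scale scale f" "subspace U" "U \<noteq> UNIV"
    and "\<And>x. f x - x \<in> U" "f ^^ (q * s) = id" "\<not> p dvd s"
  obtains v where "v \<notin> U" "(f ^^ q) v = v"
proof -
  interpret f: Vector_Spaces.linear scale scale "f ^^ q" using funpow_linear[OF assms(1)] .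
  obtain x where x: "x \<notin> U" using assms(3) by blast
  define v where "v = (\<Sum>j<s. (f ^^ (q * j)) x)"
  have U: "(f ^^ k) x - x \<in> U" for k
  proof (induction k)
    case (Suc k)
    then show ?case using subspace_add[OF assms(2) assms(4)[of "(f ^^ k) x"] Suc] by simp
  qed (simp add: subspace_0 assms)
  have "(f ^^ q) v - v = (\<Sum>j<s. (f ^^ (q * Suc j)) x - (f ^^ (q * j)) x)"
    by (simp add: v_def f.sum sum_subtractf funpow_add)
  also have "\<dots> = 0" using assms(5) by (subst sum_lessThan_telescope) simp
  finally have "(f ^^ q) v = v" by simp
  moreover have "v - scale (of_nat s) x = (\<Sum>j<s. (f ^^ (q * j)) x - x)"
    unfolding v_def sum_subtractf by (simp add: sum_constant_scale)
  then have vU: "v - scale (of_nat s) x \<in> U" using U by (simp add: subspace_sum assms)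
  have "v \<notin> U"
  proof
    assume "v \<in> U"
    then have "scale (of_nat s) x \<in> U" using subspace_diff[OF assms(2) _ vU] by force
    then have "scale (inverse (of_nat s)) (scale (of_nat s) x) \<in> U" by (rule subspace_scale[OF assms(2)])
    then show False using x assms(6) of_nat_eq_0 by simp
  qed
  ultimately show ?thesis using that by blast
qed

section \<open>Functionals, hyperplanes and the extension of intertwiners\<close>

lemma functional_nonzero:
  assumes "a \<noteq> 0"
  obtains L where "Vector_Spaces.linear scale (*) L" "L a \<noteq> (0::'f)"
proof -
  interpret vector_space_pair scale "(*) :: 'f \<Rightarrow> 'f \<Rightarrow> 'f"
    by unfold_locales (simp_all add: algebra_simps)
  have "independent {a}" using assms by (simp add: dependent_single)
  from linear_independent_extend[OF this, of "\<lambda>_. 1"] show ?thesis using that by auto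
qed

text \<open>If neither \<open>K\<close> nor \<open>L\<close> is nonzero at both vectors, then
  \<open>K b = 0\<close> and \<open>L a = 0\<close>, so the sum \<open>K + L\<close> is nonzero at
  both.\<close>

lemma functional_nonzero_pair:
  assumes "a \<noteq> 0" "b \<noteq> 0"
  obtains L where "Vector_Spaces.linear scale (*) L" "L a \<noteq> (0::'f)" "L b \<noteq> 0"
proof -
  obtain K where K: "Vector_Spaces.linear scale (*) K" "K a \<noteq> (0::'f)"
    using functional_nonzero assms(1) by blast
  obtain L where L: "Vector_Spaces.linear scale (*) L" "L b \<noteq> (0::'f)"
    using functional_nonzero assms(2) by blast
  have "Vector_Spaces.linear scale (*) (\<lambda>x. K x + L x)"
    using K(1) L(1) by (auto simp: Vector_Spaces.linear_iff algebra_simps)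
  then show ?thesis using that K L by (metis add_cancel_right_left add.right_neutral)
qed

text \<open>\<open>h y\<close> is the coordinate of \<open>y\<close> along \<open>v\<close> with
  respect to \<open>U\<close> and the line of \<open>v\<close>. It is unique because
  \<open>v\<close> lies outside \<open>U\<close>, and uniqueness gives additivity.\<close>

lemma hyperplane_functional:
  assumes "subspace U" "v \<notin> U" "\<And>y. \<exists>c. y - scale c v \<in> U"
  obtains h :: "'v \<Rightarrow> 'f" where "\<And>x y. h (x + y) = h x + h y"
    "\<And>y. y - scale (h y) v \<in> U" "\<And>y. h y = 0 \<longleftrightarrow> y \<in> U"
proof -
  obtain h where h: "\<And>y. y - scale (h y) v \<in> U" using assms(3) by metis
  have uniq: "c = d" if "y - scale c v \<in> U" "y - scale d v \<in> U" for c d y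
  proof (rule ccontr)
    assume "c \<noteq> d"
    have "scale (c - d) v \<in> U" using subspace_diff[OF assms(1) that(2,1)]
      by (simp add: algebra_simps)
    then have "scale (inverse (c - d)) (scale (c - d) v) \<in> U" by (rule subspace_scale[OF assms(1)])
    then show False using assms(2) \<open>c \<noteq> d\<close> by simp
  qed
  have "h (x + y) = h x + h y" for x y
    using subspace_add[OF assms(1) h[of x] h[of y]] by (intro uniq[OF h]) (simp add: algebra_simps)
  moreover have "h y = 0 \<longleftrightarrow> y \<in> U" for y using h[of y] uniq[OF h[of y], of 0] by auto
  ultimately show ?thesis using that h by blast
qed

text \<open>The \<open>codim\<close> assumptions express that \<open>U\<close> and \<open>U'\<close>
  are hyperplanes: every outside vector spans a complement. In the application a suitable power of
  the given map takes the place of \<open>\<beta>\<close>.\<close>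

lemma extend_conjugation:
  assumes lin: "Vector_Spaces.linear scale scale \<alpha>" "Vector_Spaces.linear scale scale \<beta>"
    and sub: "subspace U" "subspace U'"
    and proper: "U \<noteq> UNIV" "U' \<noteq> UNIV"
    and codim: "\<And>v y. v \<notin> U \<Longrightarrow> \<exists>c. y - scale c v \<in> U"
      "\<And>v y. v \<notin> U' \<Longrightarrow> \<exists>c. y - scale c v \<in> U'"
    and triv: "\<And>x. \<alpha> x - x \<in> U" "\<And>x. \<beta> x - x \<in> U'"
    and \<theta>_add: "\<And>x y. x \<in> U \<Longrightarrow> y \<in> U \<Longrightarrow> \<theta> (x + y) = \<theta> x + \<theta> y"
    and \<theta>: "bij_betw \<theta> U U'" "\<And>x. x \<in> U \<Longrightarrow> \<theta> (\<alpha> x) = \<beta> (\<theta> x)"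
    and M: "\<And>x. x \<in> U \<Longrightarrow> (\<alpha> ^^ M) x = x" "\<alpha> ^^ M \<noteq> id" "\<beta> ^^ M \<noteq> id"
    and m: "m > 0" "\<alpha> ^^ m = id" "\<beta> ^^ m = id"
  obtains \<gamma> where "Vector_Spaces.linear scale scale \<gamma>" "bij \<gamma>" "\<gamma> \<circ> \<alpha> = \<beta> \<circ> \<gamma>"
proof -
  interpret \<alpha>: Vector_Spaces.linear scale scale \<alpha> by fact
  interpret \<beta>: Vector_Spaces.linear scale scale \<beta> by fact
  interpret \<alpha>k: Vector_Spaces.linear scale scale "\<alpha> ^^ k" for k using funpow_linear[OF lin(1)] .
  interpret \<beta>k: Vector_Spaces.linear scale scale "\<beta> ^^ k" for k using funpow_linear[OF lin(2)] .
  have \<alpha>U: "\<alpha> x \<in> U" if "x \<in> U" for x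
    using subspace_add[OF sub(1) triv(1)[of x] that] by simp
  have \<beta>U: "\<beta> x \<in> U'" if "x \<in> U'" for x
    using subspace_add[OF sub(2) triv(2)[of x] that] by simp
  have \<alpha>kU: "(\<alpha> ^^ k) x \<in> U" if "x \<in> U" for x k using that by (induction k) (auto simp: \<alpha>U)
  have \<beta>kU: "(\<beta> ^^ k) x \<in> U'" if "x \<in> U'" for x k using that by (induction k) (auto simp: \<beta>U)
  have \<theta>U: "\<theta> x \<in> U'" if "x \<in> U" for x using \<theta>(1) that by (auto simp: bij_betw_def)
  have \<theta>k: "\<theta> ((\<alpha> ^^ k) x) = (\<beta> ^^ k) (\<theta> x)" if "x \<in> U" for x k
    by (induction k) (simp_all add: \<theta> that \<alpha>kU)
  have \<theta>_scale: "\<theta> (scale c x) = scale c (\<theta> x)" if "x \<in> U" for c x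
    using additive_on_scale[of U \<theta>] sub \<theta>_add that by blast
  have \<theta>_0: "\<theta> 0 = 0" using \<theta>_add[of 0 0] subspace_0[OF sub(1)] by simp
  have \<theta>_inj: "x = y" if "\<theta> x = \<theta> y" "x \<in> U" "y \<in> U" for x y
    using \<theta>(1) that by (auto simp: bij_betw_def inj_on_def)
  have \<theta>_sum: "\<theta> (\<Sum>i\<in>I. g i) = (\<Sum>i\<in>I. \<theta> (g i))" if "\<And>i. g i \<in> U" for g and I :: "nat set"
    by (induction I rule: infinite_finite_induct)
      (auto simp: \<theta>_0 \<theta>_add that subspace_sum sub)
  have MU': "(\<beta> ^^ M) x = x" if x: "x \<in> U'" for x
  proof -
    obtain y where "y \<in> U" "x = \<theta> y" using \<theta>(1) x by (auto simp: bij_betw_def)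
    then show ?thesis using \<theta>k M(1) by metis
  qed

  have "p > 1" using prime_p prime_gt_1_nat by blast
  \<comment> \<open>The p-part \<open>p ^ t\<close> of \<open>m\<close> is the power q of the
    overview; averaging over the prime-to-p part \<open>s\<close> produces \<open>v\<close> and
    \<open>w\<close>.\<close>
  then obtain t s where ms: "m = p ^ t * s" "\<not> p dvd s"
    using multiplicity_decompose'[of m p] m(1) by (metis less_numeral_extra(3) nat_dvd_1_iff_1 less_irrefl)
  obtain v where v: "v \<notin> U" "(\<alpha> ^^ (p ^ t)) v = v"
    using fixed_vector_outside_subspace[OF lin(1) sub(1) proper(1) triv(1), of "p^t" s] m ms by metis
  obtain w where w: "w \<notin> U'" "(\<beta> ^^ (p ^ t)) w = w"
    using fixed_vector_outside_subspace[OF lin(2) sub(2) proper(2) triv(2), of "p^t" s] m ms by metis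
  obtain h :: "'v \<Rightarrow> 'f" where h: "\<And>x y. h (x + y) = h x + h y"
    "\<And>y. y - scale (h y) v \<in> U" "\<And>y. h y = 0 \<longleftrightarrow> y \<in> U"
    using hyperplane_functional[OF sub(1) v(1) codim(1)[OF v(1)]] by metis

  define u where "u = \<alpha> v - v"
  define u' where "u' = \<beta> w - w"
  define a where "a = (\<alpha> ^^ M) v - v"
  define b where "b = (\<beta> ^^ M) w - w"
  have uU: "u \<in> U" "u' \<in> U'" using triv by (auto simp: u_def u'_def)
  \<comment> \<open>Telescoping expresses the value of \<open>\<alpha> ^^ M - 1\<close> at
    \<open>v\<close> through the iterates of \<open>\<alpha>\<close> at \<open>u\<close>.\<close>
  have a_sum: "a = (\<Sum>i<M. (\<alpha> ^^ i) u)"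
    using sum_lessThan_telescope[of "\<lambda>i. (\<alpha> ^^ i) v" M]
    by (simp add: a_def u_def \<alpha>k.diff funpow_swap1)
  have b_sum: "b = (\<Sum>i<M. (\<beta> ^^ i) u')"
    using sum_lessThan_telescope[of "\<lambda>i. (\<beta> ^^ i) w" M]
    by (simp add: b_def u'_def \<beta>k.diff funpow_swap1)
  have aU: "a \<in> U" unfolding a_sum by (intro subspace_sum sub \<alpha>kU uU)
  have bU: "b \<in> U'" unfolding b_sum by (intro subspace_sum sub \<beta>kU uU)
  \<comment> \<open>\<open>y\<close> differs from \<open>scale (h y) v\<close> by an element of
    \<open>U\<close>, where \<open>\<alpha> ^^ M\<close> is trivial; so
    \<open>\<alpha> ^^ M - 1\<close> is determined by its value \<open>a\<close> at
    \<open>v\<close>.\<close>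
  have \<alpha>M: "(\<alpha> ^^ M) y - y = scale (h y) a" for y
  proof -
    have "(\<alpha> ^^ M) (y - scale (h y) v) = y - scale (h y) v" using h(2) M(1) by blast
    then show ?thesis by (simp add: a_def \<alpha>k.diff \<alpha>k.scale algebra_simps)
  qed
  have "a \<noteq> 0" using \<alpha>M M(2) by (auto simp: fun_eq_iff)
  have "b \<noteq> 0"
  proof
    assume b0: "b = 0"
    have "(\<beta> ^^ M) y = y" for y
    proof -
      obtain c where "y - scale c w \<in> U'" using codim(2) w(1) by blast
      then have "(\<beta> ^^ M) (y - scale c w) = y - scale c w" using MU' by blast
      then show ?thesis using b0 by (simp add: b_def \<beta>k.diff \<beta>k.scale algebra_simps)
    qed
    then show False using M(3) by auto
  qed
  obtain b' where b': "b' \<in> U" "\<theta> b' = b" using \<theta>(1) bU by (auto simp: bij_betw_def)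
  have "b' \<noteq> 0" using b' \<theta>_0 \<open>b \<noteq> 0\<close> by auto
  \<comment> \<open>\<open>L a\<close> has to be nonzero to normalise \<open>z\<close>, and
    \<open>L b'\<close> to make the corrected map injective.\<close>
  obtain L where L: "Vector_Spaces.linear scale (*) L" "L a \<noteq> (0::'f)" "L b' \<noteq> 0"
    using functional_nonzero_pair[OF \<open>a \<noteq> 0\<close> \<open>b' \<noteq> 0\<close>] by blast
  interpret L: Vector_Spaces.linear scale "(*)" L by fact

  \<comment> \<open>Without correction the extension of \<open>\<theta>\<close> fails to intertwine
    by \<open>scale (h y) (\<theta> u - u')\<close>. The commutator of \<open>f\<close> is
    \<open>scale (h y * L a) z\<close>, and this \<open>z\<close> makes the two cancel.\<close>
  define z where "z = scale (inverse (L a)) (u' - \<theta> u)"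
  have zU: "z \<in> U'" by (auto simp: z_def intro!: subspace_scale subspace_diff sub \<theta>U uU)
  have u_fix: "(\<alpha> ^^ (p ^ t)) u = u"
    using v(2) by (simp add: u_def \<alpha>k.diff funpow_swap1[symmetric])
  have "(\<beta> ^^ (p ^ t)) u' = u'"
    using w(2) by (simp add: u'_def \<beta>k.diff funpow_swap1[symmetric])
  then have z_fix: "(\<beta> ^^ (p ^ t)) z = z"
    using \<theta>k[OF uU(1), of "p ^ t"] u_fix by (simp add: z_def \<beta>k.diff \<beta>k.scale)
  \<comment> \<open>At a vector \<open>x\<close> fixed by \<open>\<alpha>\<close>,
    \<open>f x\<close> is \<open>L x\<close> times this sum.\<close>
  have z_sum: "(\<Sum>i<M. (\<beta> ^^ i) z) = scale (inverse (L a)) (b - \<theta> a)"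
    by (simp add: z_def \<beta>k.diff \<beta>k.scale a_sum b_sum \<theta>_sum \<alpha>kU uU \<theta>k sum_subtractf
        flip: scale_sum_right)

  define f where "f y = (\<Sum>i<M. scale (L ((\<alpha> ^^ (M - Suc i)) y)) ((\<beta> ^^ i) z))" for y
  have f_add: "f (x + y) = f x + f y" for x y
    by (simp add: f_def \<alpha>k.add L.add scale_left_distrib sum.distrib)
  have fU: "f y \<in> U'" for y
    unfolding f_def by (intro subspace_sum subspace_scale sub \<beta>kU zU)
  have f_fix: "(\<beta> ^^ (p ^ t)) (f y) = f y" for y
  proof -
    have "(\<beta> ^^ (p ^ t)) ((\<beta> ^^ i) z) = (\<beta> ^^ i) z" for i
      using z_fix by (metis add.commute comp_apply funpow_add)
    then show ?thesis by (simp add: f_def \<beta>k.sum \<beta>k.scale)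
  qed
  have f_comm: "f (\<alpha> y) - \<beta> (f y) = scale (h y) (u' - \<theta> u)" for y
  proof -
    \<comment> \<open>Applying \<open>\<alpha>\<close> to the argument of \<open>f\<close> turns its
      i-th summand into \<open>g i\<close>, and applying \<open>\<beta>\<close> to its value turns
      that summand into \<open>g (Suc i)\<close>; the difference of the sums telescopes.\<close>
    define g where "g i = scale (L ((\<alpha> ^^ (M - i)) y)) ((\<beta> ^^ i) z)" for i
    have "f (\<alpha> y) = (\<Sum>i<M. g i)"
      unfolding f_def g_def
    proof (rule sum.cong)
      fix i assume "i \<in> {..<M}"
      then have "M - i = Suc (M - Suc i)" by auto
      then show "scale (L ((\<alpha> ^^ (M - Suc i)) (\<alpha> y))) ((\<beta> ^^ i) z) = scale (L ((\<alpha> ^^ (M - i)) y)) ((\<beta> ^^ i) z)"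
        by (simp add: funpow_swap1)
    qed simp
    moreover have "\<beta> (f y) = (\<Sum>i<M. g (Suc i))"
      by (simp add: f_def g_def \<beta>.sum \<beta>.scale)
    ultimately have "f (\<alpha> y) - \<beta> (f y) = g 0 - g M"
      by (simp add: sum_lessThan_telescope' flip: sum_subtractf)
    also have "\<dots> = scale (L ((\<alpha> ^^ M) y - y)) z"
      using MU'[OF zU] by (simp add: g_def L.diff scale_left_diff_distrib)
    also have "\<dots> = scale (h y) (u' - \<theta> u)"
      using L(2) by (simp add: \<alpha>M L.scale z_def)
    finally show ?thesis .
  qed

  define \<gamma> where "\<gamma> y = \<theta> (y - scale (h y) v) + scale (h y) w + f y" for y
  have \<gamma>_add: "\<gamma> (x + y) = \<gamma> x + \<gamma> y" for x y
    using \<theta>_add[OF h(2)[of x] h(2)[of y]]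
    by (simp add: \<gamma>_def f_add h(1) algebra_simps)
  have \<gamma>_lin: "Vector_Spaces.linear scale scale \<gamma>" using \<gamma>_add by (rule additive_imp_linear)
  interpret \<gamma>: Vector_Spaces.linear scale scale \<gamma> by fact
  have comm: "\<gamma> (\<alpha> y) = \<beta> (\<gamma> y)" for y
  proof -
    have "h (\<alpha> y - y) = 0" using triv h(3) by blast
    then have hy: "h (\<alpha> y) = h y" using h(1)[of "\<alpha> y - y" y] by simp
    have "\<alpha> y - scale (h y) v = \<alpha> (y - scale (h y) v) + scale (h y) u"
      by (simp add: u_def \<alpha>.diff \<alpha>.scale algebra_simps)
    then have "\<theta> (\<alpha> y - scale (h y) v) = \<beta> (\<theta> (y - scale (h y) v)) + scale (h y) (\<theta> u)"
      by (simp add: \<theta>_add \<alpha>U h(2) subspace_scale sub uU \<theta>_scale \<theta>(2))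
    then show ?thesis using f_comm[of y]
      by (simp add: \<gamma>_def hy \<beta>.add \<beta>.scale u'_def algebra_simps)
  qed
  \<comment> \<open>All terms of \<open>\<gamma> y\<close> other than \<open>scale (h y) w\<close>
    lie in \<open>U'\<close>, and \<open>w\<close> does not, so \<open>h y = 0\<close>.\<close>
  have ker: "y \<in> U \<and> \<theta> y = - f y" if "\<gamma> y = 0" for y
  proof -
    have "scale (h y) w \<in> U'"
    proof -
      have "scale (h y) w = - (\<theta> (y - scale (h y) v) + f y)"
        using that by (simp add: \<gamma>_def algebra_simps eq_neg_iff_add_eq_0)
      then show ?thesis using subspace_neg[OF sub(2) subspace_add[OF sub(2) \<theta>U[OF h(2)] fU]] by metis
    qed
    then have "scale (inverse (h y)) (scale (h y) w) \<in> U'" by (rule subspace_scale[OF sub(2)])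
    then have "h y = 0" using w(1) by (cases "h y = 0") auto
    then show ?thesis using that h(3)[of y] by (simp add: \<gamma>_def eq_neg_iff_add_eq_0)
  qed
  have "y = 0" if y: "\<gamma> y = 0" for y
  proof (rule ccontr)
    assume "y \<noteq> 0"
    \<comment> \<open>On the kernel \<open>\<theta> y = - f y\<close> is fixed by
      \<open>\<beta> ^^ (p ^ t)\<close>, hence \<open>y\<close> is fixed by
      \<open>\<alpha> ^^ (p ^ t)\<close>. A nonzero kernel would then contain a nonzero vector fixed
      by \<open>\<alpha>\<close>.\<close>
    have "\<theta> ((\<alpha> ^^ (p ^ t)) y) = \<theta> y"
      using ker[OF y] f_fix[of y] \<theta>k[of y "p ^ t"] by (simp add: \<beta>k.neg)
    then have "(\<alpha> ^^ (p ^ t)) y = y" using \<theta>_inj ker[OF y] \<alpha>kU by blast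
    moreover have "\<gamma> (\<alpha> x - x) = 0" if "\<gamma> x = 0" for x using that by (simp add: \<gamma>.diff comm)
    ultimately obtain x where x: "\<gamma> x = 0" "x \<noteq> 0" "\<alpha> x = x"
      using fixed_vector_of_p_power_order[OF lin(1), of "{x. \<gamma> x = 0}" y t] y \<open>y \<noteq> 0\<close> by auto
    have "(\<alpha> ^^ k) x = x" for k using x(3) by (induction k) auto
    then have "f x = scale (L x) (scale (inverse (L a)) (b - \<theta> a))"
      by (simp add: f_def flip: z_sum scale_sum_right)
    also have "\<dots> = \<theta> (scale (L x * inverse (L a)) (b' - a))"
    proof -
      have "\<theta> ((b' - a) + a) = \<theta> (b' - a) + \<theta> a"
        using b' aU by (intro \<theta>_add subspace_diff sub)
      then have "b - \<theta> a = \<theta> (b' - a)" using b' by (simp add: algebra_simps)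
      then show ?thesis using b' aU by (simp add: \<theta>_scale subspace_diff sub)
    qed
    finally have "\<theta> x + \<theta> (scale (L x * inverse (L a)) (b' - a)) = 0" using ker[OF x(1)] by simp
    moreover have dU: "scale (L x * inverse (L a)) (b' - a) \<in> U"
      by (intro subspace_scale subspace_diff sub b' aU)
    ultimately have "\<theta> (x + scale (L x * inverse (L a)) (b' - a)) = \<theta> 0"
      using ker[OF x(1)] by (simp only: \<theta>_0 \<theta>_add)
    then have x0: "x + scale (L x * inverse (L a)) (b' - a) = 0"
      using ker[OF x(1)] dU subspace_add[OF sub(1)] subspace_0[OF sub(1)]
      by (metis \<theta>_inj)
    \<comment> \<open>Under \<open>L\<close> the contribution of \<open>a\<close> cancels
      \<open>L x\<close>, leaving \<open>L x * inverse (L a) * L b' = 0\<close>. By the choice of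
      \<open>L\<close> this gives \<open>L x = 0\<close>, and then \<open>x = 0\<close>.\<close>
    then have "L (x + scale (L x * inverse (L a)) (b' - a)) = 0" using L.zero by simp
    then have "L x + (L x * inverse (L a) * L b' - L x * inverse (L a) * L a) = 0"
      by (simp only: L.add L.scale L.diff right_diff_distrib)
    moreover have "L x * inverse (L a) * L a = L x" using L(2) by simp
    ultimately have "L x * inverse (L a) * L b' = 0" by (simp only: add_diff_eq add_diff_cancel_left')
    then have "L x = 0" using L(2,3) by simp
    then show False using x0 x(2) by simp
  qed
  then have "inj \<gamma>" by (metis \<gamma>.diff injI right_minus_eq)
  then have "bij \<gamma>" using finite_space by (simp add: bij_def finite_UNIV_inj_surj)
  then show ?thesis using that \<gamma>_lin comm by (auto simp: fun_eq_iff)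
qed

end

section \<open>Isomorphisms between holomorphs of cyclic groups of maps\<close>

abbreviation powers :: "('a \<Rightarrow> 'a) \<Rightarrow> ('a \<Rightarrow> 'a) set" where
  "powers f \<equiv> range (\<lambda>i. f ^^ i)"

lemma id_in_powers: "id \<in> powers f"
  by (rule range_eqI[of _ _ 0]) simp

lemma self_in_powers: "f \<in> powers f"
  by (rule range_eqI[of _ _ 1]) simp

lemma comp_in_powers:
  assumes "g \<in> powers f" "h \<in> powers f"
  shows "g \<circ> h \<in> powers f"
proof -
  obtain i j where "g = f ^^ i" "h = f ^^ j" using assms by blast
  then have "g \<circ> h = f ^^ (i + j)" by (simp only: funpow_add)
  then show ?thesis by (rule range_eqI)
qed

lemma powers_commute:
  assumes "g \<in> powers f" "h \<in> powers f"
  shows "g \<circ> h = h \<circ> g"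
proof -
  obtain i j where "g = f ^^ i" "h = f ^^ j" using assms by blast
  moreover have "f ^^ i \<circ> f ^^ j = f ^^ j \<circ> f ^^ i"
    unfolding funpow_add[symmetric] by (simp only: add.commute)
  ultimately show ?thesis by simp
qed

text \<open>An isomorphism with the multiplication of the holomorphs unfolded into sums and
  compositions. The common order \<open>m\<close> is justified by counting when the locale is
  instantiated.\<close>

locale holomorph_iso = prime_field_space scale p
  for scale :: "'f::field \<Rightarrow> 'v::ab_group_add \<Rightarrow> 'v" and p +
  fixes \<alpha> \<beta> :: "'v \<Rightarrow> 'v" and m :: nat and \<phi> :: "'v \<times> ('v \<Rightarrow> 'v) \<Rightarrow> 'v \<times> ('v \<Rightarrow> 'v)"
  assumes lin: "Vector_Spaces.linear scale scale \<alpha>" "Vector_Spaces.linear scale scale \<beta>"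
    and m_pos: "m > 0"
    and order: "\<And>i. \<alpha> ^^ i = id \<longleftrightarrow> m dvd i" "\<And>i. \<beta> ^^ i = id \<longleftrightarrow> m dvd i"
    and bij_\<phi>: "bij_betw \<phi> (UNIV \<times> powers \<alpha>) (UNIV \<times> powers \<beta>)"
    and hom_\<phi>: "\<And>x y g h. g \<in> powers \<alpha> \<Longrightarrow> h \<in> powers \<alpha> \<Longrightarrow>
      \<phi> (x + g y, g \<circ> h) =
        (fst (\<phi> (x, g)) + snd (\<phi> (x, g)) (fst (\<phi> (y, h))), snd (\<phi> (x, g)) \<circ> snd (\<phi> (y, h)))"
begin

text \<open>On all of V this is only a crossed homomorphism, twisted by \<open>c\<close>; it becomes
  additive where \<open>c\<close> is trivial.\<close>

definition \<theta> :: "'v \<Rightarrow> 'v" where "\<theta> x = fst (\<phi> (x, id))"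

text \<open>The obstruction to \<open>\<phi>\<close> mapping V into V: a homomorphism from V to the
  powers of \<open>\<beta>\<close>, with kernel \<open>U\<close>.\<close>

definition c :: "'v \<Rightarrow> 'v \<Rightarrow> 'v" where "c x = snd (\<phi> (x, id))"

definition U :: "'v set" where "U = {x. c x = id}"

lemma surj_\<phi>:
  assumes "g \<in> powers \<beta>"
  obtains x h where "h \<in> powers \<alpha>" "\<phi> (x, h) = (y, g)"
proof -
  have "(y, g) \<in> \<phi> ` (UNIV \<times> powers \<alpha>)"
    unfolding bij_betw_imp_surj_on[OF bij_\<phi>] by (rule SigmaI, rule UNIV_I, rule assms)
  then obtain q where q: "(y, g) = \<phi> q" "q \<in> UNIV \<times> powers \<alpha>" by (rule imageE)
  show ?thesis
  proof (rule that)
    show "snd q \<in> powers \<alpha>" using q(2) by (simp only: mem_Times_iff)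
    show "\<phi> (fst q, snd q) = (y, g)" using q(1) by (simp only: prod.collapse)
  qed
qed

lemma inv_\<phi>: "g \<in> powers \<alpha> \<Longrightarrow> inv_into (UNIV \<times> powers \<alpha>) \<phi> (\<phi> (x, g)) = (x, g)"
  by (rule bij_betw_inv_into_left[OF bij_\<phi>]) (rule SigmaI[OF UNIV_I])

lemma \<phi>_inv: "g \<in> powers \<beta> \<Longrightarrow> \<phi> (inv_into (UNIV \<times> powers \<alpha>) \<phi> (x, g)) = (x, g)"
  by (rule bij_betw_inv_into_right[OF bij_\<phi>]) (rule SigmaI[OF UNIV_I])

lemma \<phi>_powers:
  assumes "g \<in> powers \<alpha>"
  shows "snd (\<phi> (x, g)) \<in> powers \<beta>"
proof -
  have "\<phi> (x, g) \<in> UNIV \<times> powers \<beta>" by (rule bij_betw_apply[OF bij_\<phi>]) (rule SigmaI, rule UNIV_I, rule assms)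
  then show ?thesis by (simp only: mem_Times_iff)
qed

text \<open>Makes the situation symmetric: every fact about \<open>U\<close>,
  \<open>\<theta>\<close> and \<open>c\<close> gets a counterpart with \<open>\<alpha>\<close> and
  \<open>\<beta>\<close> exchanged.\<close>

lemma holomorph_iso_inverse:
  "holomorph_iso scale p \<beta> \<alpha> m (inv_into (UNIV \<times> powers \<alpha>) \<phi>)"
proof (intro holomorph_iso.intro holomorph_iso_axioms.intro prime_field_space_axioms lin)
  let ?\<psi> = "inv_into (UNIV \<times> powers \<alpha>) \<phi>"
  show "0 < m" by (rule m_pos)
  show "\<beta> ^^ i = id \<longleftrightarrow> m dvd i" "\<alpha> ^^ i = id \<longleftrightarrow> m dvd i" for i by (rule order)+
  show "bij_betw ?\<psi> (UNIV \<times> powers \<beta>) (UNIV \<times> powers \<alpha>)" by (rule bij_betw_inv_into[OF bij_\<phi>])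
  fix x y g h assume gh: "g \<in> powers \<beta>" "h \<in> powers \<beta>"
  obtain x' g' where 1: "g' \<in> powers \<alpha>" "\<phi> (x', g') = (x, g)"
    by (rule surj_\<phi>[OF gh(1)])
  obtain y' h' where 2: "h' \<in> powers \<alpha>" "\<phi> (y', h') = (y, h)"
    by (rule surj_\<phi>[OF gh(2)])
  have "g' \<circ> h' \<in> powers \<alpha>" using 1(1) 2(1) by (rule comp_in_powers)
  moreover have "\<phi> (x' + g' y', g' \<circ> h') = (x + g y, g \<circ> h)" using hom_\<phi>[OF 1(1) 2(1)] 1 2 by simp
  ultimately have "?\<psi> (x + g y, g \<circ> h) = (x' + g' y', g' \<circ> h')" using inv_\<phi> by metis
  moreover have "?\<psi> (x, g) = (x', g')" "?\<psi> (y, h) = (y', h')" using inv_\<phi> 1 2 by metis+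
  ultimately show "?\<psi> (x + g y, g \<circ> h) =
    (fst (?\<psi> (x, g)) + snd (?\<psi> (x, g)) (fst (?\<psi> (y, h))), snd (?\<psi> (x, g)) \<circ> snd (?\<psi> (y, h)))"
    by simp
qed

lemma \<phi>_id: "\<phi> (x, id) = (\<theta> x, c x)"
  by (simp add: \<theta>_def c_def)

lemma c_powers: "c x \<in> powers \<beta>"
  unfolding c_def by (rule \<phi>_powers[OF id_in_powers])

lemma powers_cancel: "g \<circ> f = g \<longleftrightarrow> f = id" if powers: "g \<in> powers \<beta>"
proof
  assume *: "g \<circ> f = g"
  obtain i where g: "g = \<beta> ^^ i" using powers by blast
  \<comment> \<open>The inverse of \<open>g\<close>, written with a natural exponent.\<close>
  have "\<beta> ^^ (i * (m - 1)) \<circ> g = \<beta> ^^ (i * m)"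
    using m_pos unfolding g funpow_add[symmetric] by (cases m) (auto simp: add.commute)
  then have id: "\<beta> ^^ (i * (m - 1)) \<circ> g = id" using order(2)[of "i * m"] by simp
  have "f = (\<beta> ^^ (i * (m - 1)) \<circ> g) \<circ> f" unfolding id by simp
  also have "\<dots> = \<beta> ^^ (i * (m - 1)) \<circ> g" unfolding comp_assoc * ..
  finally show "f = id" using id by simp
qed simp

lemma c_add: "c (x + y) = c x \<circ> c y"
  using hom_\<phi>[OF id_in_powers id_in_powers, of x y] by (simp add: c_def)

lemma c_0: "c 0 = id"
  using c_add[of 0 0] powers_cancel[OF c_powers, of 0 "c 0"] by simp

lemma c_scale: "c (scale (of_nat k) x) = c x ^^ k"
  by (induction k) (simp_all add: c_0 scale_left_distrib c_add id_def)

lemma subspace_U: "subspace U"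
  by (rule subspace_if_add_closed) (auto simp: U_def c_0 c_add)

text \<open>In the holomorph \<open>\<alpha> x\<close> is the conjugate of \<open>x\<close> by
  \<open>\<alpha>\<close>, and conjugation becomes trivial in the abelian group of powers of
  \<open>\<beta>\<close>; hence \<open>c (\<alpha> x) = c x\<close>.\<close>

lemma triv_U: "\<alpha> x - x \<in> U"
proof -
  have a: "\<alpha> \<in> powers \<alpha>" by (rule self_in_powers)
  let ?b = "snd (\<phi> (0, \<alpha>))"
  have b: "?b \<in> powers \<beta>" by (rule \<phi>_powers[OF a])
  have "?b \<circ> c x = snd (\<phi> (\<alpha> x, \<alpha>))"
    using hom_\<phi>[OF a id_in_powers, of 0 x] by (simp add: c_def)
  moreover have "snd (\<phi> (\<alpha> x, \<alpha>)) = c (\<alpha> x) \<circ> ?b"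
    using hom_\<phi>[OF id_in_powers a, of "\<alpha> x" 0] by (simp add: c_def)
  moreover have "c (\<alpha> x) \<circ> ?b = ?b \<circ> c (\<alpha> x)" by (rule powers_commute[OF c_powers b])
  moreover have "c (\<alpha> x) = c x \<circ> c (\<alpha> x - x)" using c_add[of x "\<alpha> x - x"] by simp
  ultimately have "(?b \<circ> c x) \<circ> c (\<alpha> x - x) = ?b \<circ> c x" by (metis comp_assoc)
  moreover have "?b \<circ> c x \<in> powers \<beta>" using b c_powers by (rule comp_in_powers)
  ultimately show ?thesis using powers_cancel unfolding U_def by (metis mem_Collect_eq)
qed

lemma \<theta>_add: "x \<in> U \<Longrightarrow> \<theta> (x + y) = \<theta> x + \<theta> y"
  using hom_\<phi>[OF id_in_powers id_in_powers, of x y] by (simp add: U_def c_def \<theta>_def)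

text \<open>The product of \<open>(0, \<alpha>)\<close> and \<open>(x, id)\<close> is also that of
  \<open>(\<alpha> x, id)\<close> and \<open>(0, \<alpha>)\<close>. Comparing first components of
  the images, \<open>z\<close> cancels because V is abelian.\<close>

lemma \<theta>_conj:
  "\<exists>z k. \<phi> (0, \<alpha>) = (z, \<beta> ^^ k) \<and> (\<forall>x\<in>U. \<theta> (\<alpha> x) = (\<beta> ^^ k) (\<theta> x))"
proof -
  have a: "\<alpha> \<in> powers \<alpha>" by (rule self_in_powers)
  obtain k where k: "snd (\<phi> (0, \<alpha>)) = \<beta> ^^ k" using \<phi>_powers[OF a] by blast
  have "\<theta> (\<alpha> x) = (\<beta> ^^ k) (\<theta> x)" if "x \<in> U" for x
  proof -
    have "\<alpha> x \<in> U" using subspace_add[OF subspace_U triv_U[of x] that] by simp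
    then show ?thesis
      using hom_\<phi>[OF a id_in_powers, of 0 x] hom_\<phi>[OF id_in_powers a, of "\<alpha> x" 0] that k
      by (simp add: U_def c_def \<theta>_def)
  qed
  moreover have "\<phi> (0, \<alpha>) = (fst (\<phi> (0, \<alpha>)), \<beta> ^^ k)" unfolding k[symmetric] by simp
  ultimately show ?thesis by blast
qed

text \<open>Since p times \<open>x\<close> is 0, the order of \<open>c x\<close> divides p. A
  nontrivial value forces p to divide \<open>m\<close>, and all values then lie in the subgroup of
  order p generated by \<open>\<beta> ^^ (m div p)\<close>.\<close>

lemma p_dvd_m: "U \<noteq> UNIV \<Longrightarrow> p dvd m"
  and c_form: "U \<noteq> UNIV \<Longrightarrow> \<exists>j. c x = \<beta> ^^ (m div p * j)"
proof -
  have pow: "m dvd i * p" if "c x = \<beta> ^^ i" for x i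
  proof -
    have "\<beta> ^^ (i * p) = id" using c_scale[of p x] that c_0 by (simp add: scale_p funpow_mult mult.commute)
    then show ?thesis using order by simp
  qed
  assume U: "U \<noteq> UNIV"
  show pm: "p dvd m"
  proof (rule ccontr)
    assume "\<not> p dvd m"
    then have "coprime m p" using prime_p prime_imp_coprime coprime_commute by blast
    then have "m dvd i" if "c x = \<beta> ^^ i" for x i
      using pow[OF that] coprime_dvd_mult_left_iff by blast
    then have "c x = id" for x using c_powers[of x] order by auto
    then show False using U by (auto simp: U_def)
  qed
  obtain i where i: "c x = \<beta> ^^ i" using c_powers by blast
  have "p > 0" using prime_p prime_gt_0_nat by blast
  then have "m div p dvd i" using pow[OF i] pm by (auto elim!: dvdE)
  then show "\<exists>j. c x = \<beta> ^^ (m div p * j)" using i by (auto elim: dvdE)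
qed

lemma c_form_outside:
  assumes "x \<notin> U"
  obtains j where "c x = \<beta> ^^ (m div p * j)" "coprime j p"
proof -
  have U: "U \<noteq> UNIV" using assms by auto
  obtain j where j: "c x = \<beta> ^^ (m div p * j)" using c_form[OF U] by blast
  have "\<not> p dvd j"
  proof
    assume "p dvd j"
    then have "m dvd m div p * j" using p_dvd_m[OF U] by (metis dvd_div_mult_self mult_dvd_mono dvd_refl)
    then show False using j order assms by (simp add: U_def)
  qed
  then show ?thesis using that j prime_p prime_imp_coprime coprime_commute by blast
qed

text \<open>\<open>c v\<close> generates the group of order p containing all values of
  \<open>c\<close>, so a multiple of \<open>v\<close> corrects \<open>y\<close> into
  \<open>U\<close>.\<close>

lemma codim_U:
  assumes v: "v \<notin> U"
  shows "\<exists>a. y - scale a v \<in> U"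
proof -
  have U: "U \<noteq> UNIV" using assms by auto
  obtain j where j: "c v = \<beta> ^^ (m div p * j)" "coprime j p" by (rule c_form_outside[OF v])
  obtain i where i: "c y = \<beta> ^^ (m div p * i)" using c_form[OF U] by blast
  obtain l where l: "[j * l = 1] (mod p)" using cong_solve_coprime_nat[OF j(2)] by auto
  \<comment> \<open>\<open>l\<close> inverts \<open>j\<close> modulo p and \<open>p - 1\<close>
    stands for -1, so \<open>j * k\<close> is congruent to the negative of \<open>i\<close>.\<close>
  define k where "k = l * ((p - 1) * i)"
  have p: "p > 0" using prime_p prime_gt_0_nat by blast
  have "[i + j * k = i + 1 * ((p - 1) * i)] (mod p)"
    unfolding k_def mult.assoc[symmetric] by (intro cong_add cong_mult cong_refl l)
  also have "i + 1 * ((p - 1) * i) = p * i" using p by (cases p) auto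
  finally have "p dvd i + j * k" by (simp add: cong_def mod_eq_0_iff_dvd)
  then have "m dvd m div p * (i + j * k)" using p_dvd_m[OF U] by (metis dvd_div_mult_self mult_dvd_mono dvd_refl)
  moreover have "c (y + scale (of_nat k) v) = \<beta> ^^ (m div p * (i + j * k))"
    unfolding c_add c_scale i j(1) funpow_mult funpow_add[symmetric]
    by (simp add: algebra_simps)
  ultimately have "y - scale (- of_nat k) v \<in> U" using order by (simp add: U_def)
  then show ?thesis by blast
qed

text \<open>\<open>I.U\<close> is the hyperplane \<open>U'\<close> of the overview when
  \<open>U\<close> is proper, and \<open>I.\<theta>\<close> is the inverse of
  \<open>\<theta>\<close> there.\<close>

interpretation I: holomorph_iso scale p \<beta> \<alpha> m "inv_into (UNIV \<times> powers \<alpha>) \<phi>"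
  by (rule holomorph_iso_inverse)

lemma \<theta>_inverse: "x \<in> U \<Longrightarrow> \<theta> x \<in> I.U \<and> I.\<theta> (\<theta> x) = x"
proof -
  assume "x \<in> U"
  then have "\<phi> (x, id) = (\<theta> x, id)" by (simp add: \<phi>_id U_def)
  moreover have "inv_into (UNIV \<times> powers \<alpha>) \<phi> (\<phi> (x, id)) = (x, id)"
    by (rule inv_\<phi>[OF id_in_powers])
  ultimately show ?thesis by (simp add: I.U_def I.c_def I.\<theta>_def)
qed

lemma inverse_\<theta>: "x \<in> I.U \<Longrightarrow> I.\<theta> x \<in> U \<and> \<theta> (I.\<theta> x) = x"
proof -
  assume "x \<in> I.U"
  then have "inv_into (UNIV \<times> powers \<alpha>) \<phi> (x, id) = (I.\<theta> x, id)" by (simp add: I.\<phi>_id I.U_def)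
  moreover have "\<phi> (inv_into (UNIV \<times> powers \<alpha>) \<phi> (x, id)) = (x, id)"
    by (rule \<phi>_inv[OF id_in_powers])
  ultimately show ?thesis by (simp add: U_def c_def \<theta>_def)
qed

lemma bij_\<theta>: "bij_betw \<theta> U I.U"
  by (rule bij_betw_byWitness[of _ I.\<theta>]) (use \<theta>_inverse inverse_\<theta> in auto)

text \<open>Since \<open>V\<close> is abelian, the preimage of \<open>V\<close> under \<open>\<phi>\<close> centralises \<open>U\<close>.\<close>
lemma pow_fixes_U:
  assumes "I.U \<noteq> UNIV" "x \<in> U"
  shows "(\<alpha> ^^ (m div p)) x = x"
proof -
  let ?M = "m div p"
  have mp: "p * ?M = m" using I.p_dvd_m[OF assms(1)] by simp
  obtain w where w: "w \<notin> I.U" using assms(1) by blast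
  obtain j where j: "I.c w = \<alpha> ^^ (?M * j)" "coprime j p" by (rule I.c_form_outside[OF w])
  define a where "a = \<alpha> ^^ (?M * j)"
  have a: "a \<in> powers \<alpha>" unfolding a_def by (rule rangeI)
  have "\<phi> (inv_into (UNIV \<times> powers \<alpha>) \<phi> (w, id)) = (w, id)"
    by (rule \<phi>_inv[OF id_in_powers])
  then have w': "\<phi> (I.\<theta> w, a) = (w, id)" by (simp add: I.\<phi>_id j(1) a_def)
  have xU: "\<phi> (x, id) = (\<theta> x, id)" using assms(2) by (simp add: \<phi>_id U_def)
  have "\<phi> (x + I.\<theta> w, a) = \<phi> (I.\<theta> w + a x, a)"
    using hom_\<phi>[OF id_in_powers a, of x "I.\<theta> w"] hom_\<phi>[OF a id_in_powers, of "I.\<theta> w" x] w' xU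
    by (simp add: add.commute)
  then have "(x + I.\<theta> w, a) = (I.\<theta> w + a x, a)" using inv_\<phi>[OF a] by metis
  then have "a x = x" by (simp add: add.commute)
  \<comment> \<open>Inverting \<open>j\<close> modulo p recovers
    \<open>\<alpha> ^^ (m div p)\<close> as a power of \<open>a\<close>, up to an exponent that is a
    multiple of \<open>m\<close>.\<close>
  obtain l where l: "[j * l = 1] (mod p)" using cong_solve_coprime_nat[OF j(2)] by auto
  define r where "r = j * l div p"
  have "j * l mod p = 1" using l prime_gt_1_nat[OF prime_p] by (simp add: cong_def)
  then have jl: "j * l = 1 + p * r" 
    using mult_div_mod_eq[of p "j * l"] unfolding r_def by linarith
  have "x = (\<alpha> ^^ (?M * j * l)) x"
    using funpow_mult_fixed[of "?M * j" \<alpha> x l] \<open>a x = x\<close> by (simp add: a_def)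
  also have "?M * j * l = ?M + (p * ?M) * r"
    unfolding mult.assoc jl by (simp only: distrib_left mult_1_right mult.left_commute)
  also have "\<dots> = ?M + m * r" unfolding mp ..
  also have "\<alpha> ^^ \<dots> = \<alpha> ^^ ?M" using order(1)[of "m * r"] by (simp add: funpow_add)
  finally show ?thesis by simp
qed

lemma I_U_proper: "U \<noteq> UNIV \<Longrightarrow> I.U \<noteq> UNIV"
  using bij_betw_same_card[OF bij_\<theta>] finite_space by (metis card_subset_eq subset_UNIV)

lemma pow_fixes_inverse_U:
  assumes "U \<noteq> UNIV" "x \<in> I.U"
  shows "(\<beta> ^^ (m div p)) x = x"
proof -
  let ?A = "UNIV \<times> powers \<alpha>" and ?B = "UNIV \<times> powers \<beta>"
  \<comment> \<open>The inverse of the inverse agrees with \<open>\<phi>\<close> on V, so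
    \<open>J.U = U\<close>, and \<open>pow_fixes_U\<close> for the inverse asks exactly that
    \<open>U\<close> be proper.\<close>
  interpret J: holomorph_iso scale p \<alpha> \<beta> m "inv_into ?B (inv_into ?A \<phi>)"
    by (rule I.holomorph_iso_inverse)
  have "inv_into ?B (inv_into ?A \<phi>) (y, id) = \<phi> (y, id)" for y
    by (rule inv_into_inv_into_eq[OF bij_\<phi>]) (use id_in_powers in blast)
  then have "J.U = U" by (simp add: J.U_def J.c_def U_def c_def)
  then show ?thesis
    using holomorph_iso.pow_fixes_U[OF holomorph_iso_inverse] assms by simp
qed

text \<open>The image of \<open>\<alpha>\<close> generates \<open>\<langle>\<beta>\<rangle>\<close> modulo the image of \<open>V\<close>.\<close>
lemma coprime_exponent:
  assumes "U \<noteq> UNIV" "\<phi> (0, \<alpha>) = (z, \<beta> ^^ k)"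
  shows "coprime k (m div p)"
proof -
  let ?M = "m div p"
  have pows: "snd (\<phi> (0, \<alpha> ^^ l)) = \<beta> ^^ (k * l)" for l
  proof (induction l)
    case 0
    then show ?case using c_0 by (simp add: c_def id_def)
  next
    case (Suc l)
    have a: "\<alpha> \<in> powers \<alpha>" by (rule self_in_powers)
    interpret \<alpha>: Vector_Spaces.linear scale scale \<alpha> by (rule lin)
    have "snd (\<phi> (0, \<alpha> \<circ> \<alpha> ^^ l)) = \<beta> ^^ k \<circ> \<beta> ^^ (k * l)"
      using hom_\<phi>[OF a, of "\<alpha> ^^ l" 0 0] Suc assms(2) by (simp add: \<alpha>.zero)
    then show ?case by (simp only: funpow.simps mult_Suc_right funpow_add)
  qed
  have "\<beta> \<in> powers \<beta>" by (rule self_in_powers)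
  then obtain x g where "g \<in> powers \<alpha>" "\<phi> (x, g) = (0, \<beta>)"
    by (rule surj_\<phi>)
  then obtain l where xl: "\<phi> (x, \<alpha> ^^ l) = (0, \<beta>)" by auto
  obtain j where j: "c x = \<beta> ^^ (?M * j)" using c_form[OF assms(1)] by blast
  \<comment> \<open>In the preimage of \<open>\<beta>\<close>, the part in V contributes an exponent
    divisible by \<open>?M\<close>, and the power of \<open>\<alpha>\<close> one divisible by
    \<open>k\<close>.\<close>
  have "\<beta> = c x \<circ> \<beta> ^^ (k * l)"
    using hom_\<phi>[OF id_in_powers, of "\<alpha> ^^ l" x 0] xl pows[of l] by (simp add: c_def)
  then have \<beta>: "\<beta> ^^ (?M * j + k * l) = \<beta>" using j by (simp add: funpow_add)
  \<comment> \<open>Adding \<open>m - 1\<close> replaces subtracting 1 modulo \<open>m\<close>. A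
    common divisor of \<open>k\<close> and \<open>?M\<close> then divides both \<open>m\<close> and
    \<open>m - 1\<close>.\<close>
  have "\<beta> ^^ (?M * j + k * l + (m - 1)) = \<beta> \<circ> \<beta> ^^ (m - 1)"
    unfolding funpow_add[of "?M * j + k * l"] \<beta> ..
  also have "\<dots> = \<beta> ^^ Suc (m - 1)" by simp
  also have "\<dots> = id" using m_pos order(2)[of m] by simp
  finally have dvd: "m dvd ?M * j + k * l + (m - 1)" using order by simp
  show ?thesis
  proof (rule coprimeI)
    fix d assume d: "d dvd k" "d dvd ?M"
    have "d dvd m" using d(2) p_dvd_m[OF assms(1)] by (metis dvd_div_mult_self dvd_mult2)
    then have "d dvd ?M * j + k * l + (m - 1)" using dvd dvd_trans by blast
    moreover have "d dvd ?M * j + k * l" using d by simp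
    ultimately have "d dvd m - 1" using dvd_add_right_iff by blast
    then have "d dvd m - (m - 1)" using \<open>d dvd m\<close> dvd_diff_nat by blast
    then show "is_unit d" using m_pos by simp
  qed
qed

lemma conjugate:
  obtains \<gamma> k where "Vector_Spaces.linear scale scale \<gamma>" "bij \<gamma>" "\<gamma> \<circ> \<alpha> = \<beta> ^^ k \<circ> \<gamma>"
proof -
  obtain z k where k: "\<phi> (0, \<alpha>) = (z, \<beta> ^^ k)" "\<And>x. x \<in> U \<Longrightarrow> \<theta> (\<alpha> x) = (\<beta> ^^ k) (\<theta> x)"
    using \<theta>_conj by metis
  show ?thesis
  proof (cases "U = UNIV")
    case True
    then have "inj \<theta>" using bij_\<theta> by (auto simp: bij_betw_def)
    then have "bij \<theta>" using finite_space by (simp add: bij_def finite_UNIV_inj_surj)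
    moreover have "Vector_Spaces.linear scale scale \<theta>"
      by (rule additive_imp_linear) (use True \<theta>_add in auto)
    ultimately show ?thesis using that k True by (auto simp: fun_eq_iff)
  next
    case False
    let ?M = "m div p"
    have IU: "I.U \<noteq> UNIV" using I_U_proper False .
    have mp: "m = p * ?M" using p_dvd_m[OF False] by simp
    have kM: "coprime k ?M" using coprime_exponent[OF False k(1)] .
    \<comment> \<open>Since \<open>\<beta> ^^ ?M\<close> is trivial on \<open>I.U\<close>, adding
      \<open>?M\<close> to the exponent does not change the action there. If p divides
      \<open>k\<close>, coprimality keeps p from dividing \<open>?M\<close>, so \<open>k'\<close>
      avoids p, which is what makes \<open>(\<beta> ^^ k') ^^ ?M\<close> nontrivial.\<close>
    define k' where "k' = (if p dvd k then k + ?M else k)"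
    have k'p: "\<not> p dvd k'"
    proof (cases "p dvd k")
      case True
      have "\<not> p dvd ?M"
      proof
        assume "p dvd ?M"
        then have "is_unit p" by (rule coprime_common_divisor[OF kM True])
        then show False using prime_p not_prime_unit by blast
      qed
      then have "\<not> p dvd k + ?M" using dvd_add_right_iff[OF True] by blast
      then show ?thesis unfolding k'_def if_P[OF True] .
    next
      case False
      then show ?thesis unfolding k'_def if_not_P[OF False] .
    qed
    have \<beta>fix: "(\<beta> ^^ ?M) x = x" if "x \<in> I.U" for x using pow_fixes_inverse_U[OF False that] .
    have k'eq: "(\<beta> ^^ k') x = (\<beta> ^^ k) x" if "x \<in> I.U" for x
      using \<beta>fix[OF that] unfolding k'_def by (simp add: funpow_add split: if_split)
    have triv: "(\<beta> ^^ i) x - x \<in> I.U" for i x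
    proof (induction i)
      case (Suc i)
      then show ?case using subspace_add[OF I.subspace_U I.triv_U[of "(\<beta> ^^ i) x"] Suc] by simp
    qed (simp add: subspace_0 I.subspace_U)
    have M: "?M < m" "?M > 0" 
      by (rule div_less_dividend[OF prime_gt_1_nat[OF prime_p] m_pos]) (metis mp m_pos gr0I mult_0_right)
    have \<alpha>M: "\<alpha> ^^ ?M \<noteq> id" using M order(1) nat_dvd_not_less by blast
    have "\<not> p * ?M dvd k' * ?M" using k'p M(2) by simp
    then have "\<not> m dvd k' * ?M" unfolding mp[symmetric] .
    then have \<beta>M: "(\<beta> ^^ k') ^^ ?M \<noteq> id" using order(2) by (simp add: funpow_mult mult.commute)
    have \<alpha>m: "\<alpha> ^^ m = id" using order(1)[of m] by simp
    have \<beta>m: "(\<beta> ^^ k') ^^ m = id" using order(2)[of "k' * m"] by (simp add: funpow_mult mult.commute)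
    have comm: "\<theta> (\<alpha> x) = (\<beta> ^^ k') (\<theta> x)" if "x \<in> U" for x
      using k(2)[OF that] k'eq \<theta>_inverse[OF that] by simp
    show ?thesis
      by (rule extend_conjugation[OF lin(1) funpow_linear[OF lin(2)] subspace_U I.subspace_U False IU
            codim_U I.codim_U triv_U triv \<theta>_add bij_\<theta> comm pow_fixes_U[OF IU] \<alpha>M \<beta>M m_pos \<alpha>m \<beta>m])
        (use that in blast)+
  qed
qed

end

section \<open>The general linear group and the holomorphs in terms of plain maps\<close>

lemma carrier_general_linear_group:
  "f \<in> carrier (general_linear_group scale) \<longleftrightarrow> Vector_Spaces.linear scale scale f \<and> bij f"
  by (simp add: general_linear_group_def)

lemma nat_pow_general_linear_group:
  assumes "vector_space scale" "f \<in> carrier (general_linear_group scale)"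
  shows "f [^]\<^bsub>general_linear_group scale\<^esub> (k::nat) = f ^^ k"
proof -
  interpret group "general_linear_group scale" using assms(1) by (rule group_general_linear_group)
  show ?thesis
  proof (induction k)
    case 0
    show ?case by (simp add: one_general_linear_group id_def)
  next
    case (Suc k)
    have "f [^]\<^bsub>general_linear_group scale\<^esub> Suc k = f ^^ k \<circ> f"
      using mult_general_linear_group[OF nat_pow_closed[OF assms(2), of k] assms(2)] Suc by simp
    also have "\<dots> = f ^^ Suc k" by (simp only: funpow_Suc_right)
    finally show ?case .
  qed
qed

text \<open>The additive group fills its whole type, so composition of extensional functions is
  ordinary composition.\<close>

lemma mult_rel_hol_additive_group:
  assumes "bij g" "bij h"
  shows "(x, g) \<otimes>\<^bsub>rel_hol additive_group H\<^esub> (y, h) = (x + g y, g \<circ> h)"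
  using assms
  by (auto simp: rel_hol_def additive_group_def AutoGroup_def BijGroup_def Bij_def extensional_def compose_def)

lemma carrier_rel_hol_additive_group: "carrier (rel_hol additive_group H) = UNIV \<times> H"
  by (simp add: rel_hol_def additive_group_def)

lemma (in vector_space) finite_span:
  assumes "finite (UNIV :: 'a set)" "finite S"
  shows "finite (span S)"
  using assms(2)
proof induction
  case (insert a S)
  have "span (insert a S) \<subseteq> (\<lambda>(k, x). scale k a + x) ` (UNIV \<times> span S)"
  proof
    fix x assume "x \<in> span (insert a S)"
    then obtain k where "x - scale k a \<in> span S" unfolding span_insert by blast
    then show "x \<in> (\<lambda>(k, x). scale k a + x) ` (UNIV \<times> span S)"
      by (intro image_eqI[of _ _ "(k, x - scale k a)"]) auto
  qed
  moreover have "finite ((\<lambda>(k, x). scale k a + x) ` (UNIV \<times> span S))"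
    using insert assms by blast
  ultimately show ?case by (rule finite_subset)
qed simp

context prime_field_space
begin

abbreviation "GL \<equiv> general_linear_group scale"

sublocale GL: group GL
  by (rule group_general_linear_group[OF vector_space_axioms])

lemma finite_GL: "finite (carrier GL)"
proof -
  have "finite {f :: 'v \<Rightarrow> 'v. \<forall>x. (x \<in> UNIV \<longrightarrow> f x \<in> UNIV) \<and> (x \<notin> UNIV \<longrightarrow> f x = 0)}"
    by (rule finite_set_of_finite_funs[OF finite_space finite_space])
  then have "finite (UNIV :: ('v \<Rightarrow> 'v) set)" by simp
  then show ?thesis by (rule rev_finite_subset) simp
qed

text \<open>In a finite group inverses are natural powers, so natural exponents already give the
  cyclic subgroup.\<close>

lemma generate_GL: "f \<in> carrier GL \<Longrightarrow> generate GL {f} = powers f"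
  using GL.generate_pow_on_finite_carrier[OF finite_GL]
  by (auto simp: nat_pow_general_linear_group[OF vector_space_axioms])

lemma funpow_eq_id_iff: "f \<in> carrier GL \<Longrightarrow> f ^^ i = id \<longleftrightarrow> GL.ord f dvd i"
  using GL.pow_eq_id[of f i] nat_pow_general_linear_group[OF vector_space_axioms, of f i]
  by (simp add: one_general_linear_group)

lemma funpow_in_GL: "f \<in> carrier GL \<Longrightarrow> f ^^ i \<in> carrier GL"
  using GL.nat_pow_closed[of f i] nat_pow_general_linear_group[OF vector_space_axioms, of f i] by simp

lemma powers_in_GL: "f \<in> carrier GL \<Longrightarrow> g \<in> powers f \<Longrightarrow> g \<in> carrier GL"
  using funpow_in_GL by auto

section \<open>Conjugate subgroups and the two directions of the equivalence\<close>

lemma conj_coset_GL: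
  "(g <#\<^bsub>GL\<^esub> H) #>\<^bsub>GL\<^esub> inv\<^bsub>GL\<^esub> g = (\<lambda>h. g \<otimes>\<^bsub>GL\<^esub> h \<otimes>\<^bsub>GL\<^esub> inv\<^bsub>GL\<^esub> g) ` H"
  by (auto simp: l_coset_def r_coset_def)

lemma card_conj_GL:
  assumes "g \<in> carrier GL" "H \<subseteq> carrier GL"
  shows "card ((\<lambda>h. g \<otimes>\<^bsub>GL\<^esub> h \<otimes>\<^bsub>GL\<^esub> inv\<^bsub>GL\<^esub> g) ` H) = card H"
proof (rule card_image, rule inj_onI)
  fix h k assume hk: "h \<in> H" "k \<in> H"
    and eq: "g \<otimes>\<^bsub>GL\<^esub> h \<otimes>\<^bsub>GL\<^esub> inv\<^bsub>GL\<^esub> g = g \<otimes>\<^bsub>GL\<^esub> k \<otimes>\<^bsub>GL\<^esub> inv\<^bsub>GL\<^esub> g"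
  have "h \<in> carrier GL" "k \<in> carrier GL" using hk assms(2) by auto
  then show "h = k" using eq assms(1) by simp
qed

text \<open>The isomorphism is \<open>\<gamma>\<close> on V paired with conjugation by
  \<open>\<gamma>\<close> on the powers of \<open>\<alpha>\<close>.\<close>

lemma rel_hol_iso_if_conjugate:
  assumes \<alpha>: "\<alpha> \<in> carrier GL" and \<beta>: "\<beta> \<in> carrier GL" and \<gamma>: "\<gamma> \<in> carrier GL"
    and conj: "powers \<beta> = (\<lambda>h. \<gamma> \<otimes>\<^bsub>GL\<^esub> h \<otimes>\<^bsub>GL\<^esub> inv\<^bsub>GL\<^esub> \<gamma>) ` powers \<alpha>"
  shows "rel_hol additive_group (powers \<alpha>) \<cong> rel_hol additive_group (powers \<beta>)"
proof -
  define c where "c h = \<gamma> \<otimes>\<^bsub>GL\<^esub> h \<otimes>\<^bsub>GL\<^esub> inv\<^bsub>GL\<^esub> \<gamma>" for h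
  define \<phi> where "\<phi> = map_prod \<gamma> c"
  interpret \<gamma>: Vector_Spaces.linear scale scale \<gamma>
    using \<gamma> carrier_general_linear_group by blast
  have mem: "h \<in> carrier GL" "bij h" if "h \<in> powers \<alpha>" for h
    using powers_in_GL[OF \<alpha> that] carrier_general_linear_group by blast+
  have c_powers: "c h \<in> powers \<beta>" if "h \<in> powers \<alpha>" for h
    unfolding conj c_def using that by (rule imageI)
  have c_bij: "bij (c h)" if "h \<in> powers \<alpha>" for h
    using powers_in_GL[OF \<beta> c_powers[OF that]] carrier_general_linear_group by blast
  have c_inj: "inj_on c (powers \<alpha>)"
  proof (rule inj_onI)
    fix h k assume "h \<in> powers \<alpha>" "k \<in> powers \<alpha>" "c h = c k"
    then show "h = k" using mem \<gamma> unfolding c_def by simp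
  qed
  \<comment> \<open>This equivariance is what makes the paired map respect the semidirect
    multiplication.\<close>
  have c_app: "c h (\<gamma> x) = \<gamma> (h x)" if h: "h \<in> powers \<alpha>" for h x
  proof -
    have "c h \<otimes>\<^bsub>GL\<^esub> \<gamma> = \<gamma> \<otimes>\<^bsub>GL\<^esub> h"
      using mem(1)[OF h] \<gamma> by (simp add: c_def GL.m_assoc)
    then have "c h \<circ> \<gamma> = \<gamma> \<circ> h"
      using mem(1)[OF h] \<gamma> powers_in_GL[OF \<beta> c_powers[OF h]] by (simp add: mult_general_linear_group)
    then show ?thesis by (simp add: fun_eq_iff)
  qed
  have c_comp: "c (h \<circ> k) = c h \<circ> c k" if hk: "h \<in> powers \<alpha>" "k \<in> powers \<alpha>" for h k
  proof -
    note C = mem(1)[OF hk(1)] mem(1)[OF hk(2)] \<gamma>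
    have "c (h \<otimes>\<^bsub>GL\<^esub> k) = c h \<otimes>\<^bsub>GL\<^esub> c k"
      unfolding c_def using C by (simp add: GL.m_assoc GL.inv_solve_left)
    then show ?thesis
      using C powers_in_GL[OF \<beta> c_powers[OF hk(1)]] powers_in_GL[OF \<beta> c_powers[OF hk(2)]]
      by (simp add: mult_general_linear_group)
  qed
  have "\<phi> \<in> iso (rel_hol additive_group (powers \<alpha>)) (rel_hol additive_group (powers \<beta>))"
    unfolding iso_def
  proof (intro CollectI conjI)
    show "\<phi> \<in> hom (rel_hol additive_group (powers \<alpha>)) (rel_hol additive_group (powers \<beta>))"
    proof (rule homI)
      fix x y assume xy: "x \<in> carrier (rel_hol additive_group (powers \<alpha>))"
        "y \<in> carrier (rel_hol additive_group (powers \<alpha>))"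
      obtain a h where x: "x = (a, h)" by (rule prod.exhaust)
      obtain b k where y: "y = (b, k)" by (rule prod.exhaust)
      have hk: "h \<in> powers \<alpha>" "k \<in> powers \<alpha>"
        using xy unfolding carrier_rel_hol_additive_group x y by blast+
      show "\<phi> (x \<otimes>\<^bsub>rel_hol additive_group (powers \<alpha>)\<^esub> y) = \<phi> x \<otimes>\<^bsub>rel_hol additive_group (powers \<beta>)\<^esub> \<phi> y"
        unfolding x y \<phi>_def map_prod_simp
        by (simp only: mult_rel_hol_additive_group mem[OF hk(1)] mem[OF hk(2)] c_bij hk
            map_prod_simp c_app c_comp \<gamma>.add)
    next
      fix x assume "x \<in> carrier (rel_hol additive_group (powers \<alpha>))"
      then show "\<phi> x \<in> carrier (rel_hol additive_group (powers \<beta>))"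
        using c_powers unfolding carrier_rel_hol_additive_group \<phi>_def by (simp only: mem_Times_iff fst_map_prod snd_map_prod UNIV_I simp_thms)
    qed
    have "bij_betw \<gamma> UNIV UNIV" using \<gamma> carrier_general_linear_group by blast
    moreover have "bij_betw c (powers \<alpha>) (powers \<beta>)"
      using c_inj unfolding bij_betw_def conj c_def[abs_def] by simp
    ultimately show "bij_betw \<phi> (carrier (rel_hol additive_group (powers \<alpha>))) (carrier (rel_hol additive_group (powers \<beta>)))"
      unfolding carrier_rel_hol_additive_group \<phi>_def by (rule bij_betw_map_prod)
  qed
  then show ?thesis by (auto simp: is_iso_def)
qed

text \<open>A linear bijection with
  \<open>\<gamma> \<circ> \<alpha> = \<beta> ^^ k \<circ> \<gamma>\<close> conjugates the powers of
  \<open>\<alpha>\<close> into those of \<open>\<beta>\<close>; equal finite cardinality upgrades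
  the inclusion to equality.\<close>

lemma conjugate_if_rel_hol_iso:
  assumes \<alpha>: "\<alpha> \<in> carrier GL" and \<beta>: "\<beta> \<in> carrier GL"
    and iso: "rel_hol additive_group (powers \<alpha>) \<cong> rel_hol additive_group (powers \<beta>)"
  obtains \<gamma> where "\<gamma> \<in> carrier GL"
    "powers \<beta> = (\<lambda>h. \<gamma> \<otimes>\<^bsub>GL\<^esub> h \<otimes>\<^bsub>GL\<^esub> inv\<^bsub>GL\<^esub> \<gamma>) ` powers \<alpha>"
proof -
  have sub: "powers \<alpha> \<subseteq> carrier GL" "powers \<beta> \<subseteq> carrier GL"
    using powers_in_GL \<alpha> \<beta> by blast+
  have mem: "bij g" if "g \<in> powers \<alpha> \<or> g \<in> powers \<beta>" for g
    using that sub carrier_general_linear_group by blast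
  obtain \<phi> where \<phi>: "\<phi> \<in> hom (rel_hol additive_group (powers \<alpha>)) (rel_hol additive_group (powers \<beta>))"
    "bij_betw \<phi> (UNIV \<times> powers \<alpha>) (UNIV \<times> powers \<beta>)"
    using iso unfolding is_iso_def iso_def carrier_rel_hol_additive_group by blast
  \<comment> \<open>Cancelling the finite nonzero cardinality of V from the orders of the holomorphs
    equates the orders of the cyclic groups.\<close>
  have card: "card (powers \<alpha>) = card (powers \<beta>)"
  proof -
    have "card (UNIV :: 'v set) * card (powers \<alpha>) = card (UNIV :: 'v set) * card (powers \<beta>)"
      using bij_betw_same_card[OF \<phi>(2)] by (simp only: card_cartesian_product)
    then show ?thesis using finite_space by simp
  qed
  have ord: "GL.ord f = card (powers f)" if "f \<in> carrier GL" for f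
    using GL.generate_pow_card[OF that] generate_GL[OF that] by simp
  define m where "m = GL.ord \<alpha>"
  have m: "GL.ord \<beta> = m" using card ord \<alpha> \<beta> by (simp add: m_def)
  have m_pos: "m > 0" unfolding m_def using GL.ord_ge_1[OF finite_GL \<alpha>] by simp
  interpret H: holomorph_iso scale p \<alpha> \<beta> m \<phi>
  proof (intro holomorph_iso.intro holomorph_iso_axioms.intro prime_field_space_axioms m_pos \<phi>(2))
    show "Vector_Spaces.linear scale scale \<alpha>" "Vector_Spaces.linear scale scale \<beta>"
      using \<alpha> \<beta> carrier_general_linear_group by blast+
    show "\<alpha> ^^ i = id \<longleftrightarrow> m dvd i" for i unfolding m_def by (rule funpow_eq_id_iff[OF \<alpha>])
    show "\<beta> ^^ i = id \<longleftrightarrow> m dvd i" for i unfolding m[symmetric] by (rule funpow_eq_id_iff[OF \<beta>])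
    fix x y :: 'v and g h assume gh: "g \<in> powers \<alpha>" "h \<in> powers \<alpha>"
    have c: "(x, g) \<in> UNIV \<times> powers \<alpha>" "(y, h) \<in> UNIV \<times> powers \<alpha>" using gh by blast+
    have b: "bij g" "bij h" "bij (snd (\<phi> (x, g)))" "bij (snd (\<phi> (y, h)))"
      using gh bij_betw_apply[OF \<phi>(2) c(1)] bij_betw_apply[OF \<phi>(2) c(2)] mem
      unfolding mem_Times_iff by blast+
    have "\<phi> ((x, g) \<otimes>\<^bsub>rel_hol additive_group (powers \<alpha>)\<^esub> (y, h))
        = \<phi> (x, g) \<otimes>\<^bsub>rel_hol additive_group (powers \<beta>)\<^esub> \<phi> (y, h)"
      using c by (intro hom_mult[OF \<phi>(1)]) (simp_all only: carrier_rel_hol_additive_group)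
    moreover have "\<phi> (x, g) \<otimes>\<^bsub>rel_hol additive_group (powers \<beta>)\<^esub> \<phi> (y, h) =
        (fst (\<phi> (x, g)) + snd (\<phi> (x, g)) (fst (\<phi> (y, h))), snd (\<phi> (x, g)) \<circ> snd (\<phi> (y, h)))"
      using mult_rel_hol_additive_group[OF b(3,4), of "powers \<beta>" "fst (\<phi> (x, g))" "fst (\<phi> (y, h))"]
      by (simp only: prod.collapse)
    ultimately show "\<phi> (x + g y, g \<circ> h) =
        (fst (\<phi> (x, g)) + snd (\<phi> (x, g)) (fst (\<phi> (y, h))), snd (\<phi> (x, g)) \<circ> snd (\<phi> (y, h)))"
      by (simp only: mult_rel_hol_additive_group[OF b(1,2)])
  qed
  obtain \<gamma> k where \<gamma>: "Vector_Spaces.linear scale scale \<gamma>" "bij \<gamma>" "\<gamma> \<circ> \<alpha> = \<beta> ^^ k \<circ> \<gamma>"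
    by (rule H.conjugate)
  have \<gamma>GL: "\<gamma> \<in> carrier GL" using \<gamma> carrier_general_linear_group by blast
  let ?c = "\<lambda>h. \<gamma> \<otimes>\<^bsub>GL\<^esub> h \<otimes>\<^bsub>GL\<^esub> inv\<^bsub>GL\<^esub> \<gamma>"
  have comm: "\<gamma> \<circ> \<alpha> ^^ i = \<beta> ^^ (k * i) \<circ> \<gamma>" for i
  proof (induction i)
    case (Suc i)
    have "\<gamma> \<circ> \<alpha> ^^ Suc i = (\<gamma> \<circ> \<alpha>) \<circ> \<alpha> ^^ i" by (simp only: funpow.simps comp_assoc)
    also have "\<dots> = \<beta> ^^ k \<circ> (\<gamma> \<circ> \<alpha> ^^ i)" by (simp only: \<gamma>(3) comp_assoc)
    also have "\<dots> = \<beta> ^^ (k * Suc i) \<circ> \<gamma>" by (simp only: Suc mult_Suc_right funpow_add comp_assoc)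
    finally show ?case .
  qed (simp add: id_def)
  have "?c h \<in> powers \<beta>" if h\<alpha>: "h \<in> powers \<alpha>" for h
  proof -
    obtain i where h: "h = \<alpha> ^^ i" using h\<alpha> by blast
    have "\<gamma> \<otimes>\<^bsub>GL\<^esub> h = \<beta> ^^ (k * i) \<otimes>\<^bsub>GL\<^esub> \<gamma>"
      using comm[of i] unfolding h
      by (simp only: mult_general_linear_group \<gamma>GL funpow_in_GL \<alpha> \<beta>)
    then have "?c h = \<beta> ^^ (k * i)"
      using \<gamma>GL funpow_in_GL[OF \<beta>, of "k * i"] by (simp add: GL.m_assoc)
    then show ?thesis by simp
  qed
  then have "?c ` powers \<alpha> \<subseteq> powers \<beta>" by blast
  moreover have "card (?c ` powers \<alpha>) = card (powers \<beta>)" using card_conj_GL[OF \<gamma>GL sub(1)] card by simp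
  moreover have "finite (powers \<beta>)" using finite_subset[OF sub(2) finite_GL] .
  ultimately have "?c ` powers \<alpha> = powers \<beta>" by (metis card_subset_eq)
  then show ?thesis using that \<gamma>GL by metis
qed

end

theorem theorem4p1:
  fixes scale :: "'f::field \<Rightarrow> 'v::ab_group_add \<Rightarrow> 'v"
    and Basis :: "'v set"
    and p n :: nat
    and \<alpha> \<beta> :: "'v \<Rightarrow> 'v"
  assumes "prime p"
    and "card (UNIV :: 'f set) = p"
    and "finite_dimensional_vector_space scale Basis"
    and "vector_space.dim scale (UNIV :: 'v set) = n"
    and "n > 0"
    and "\<alpha> \<in> carrier (general_linear_group scale)"
    and "\<beta> \<in> carrier (general_linear_group scale)"
  shows "rel_hol additive_group (generate (general_linear_group scale) {\<alpha>})
           \<cong> rel_hol additive_group (generate (general_linear_group scale) {\<beta>})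
         \<longleftrightarrow>
         (\<exists>\<gamma> \<in> carrier (general_linear_group scale).
            generate (general_linear_group scale) {\<beta>}
            = (\<gamma> <#\<^bsub>general_linear_group scale\<^esub> generate (general_linear_group scale) {\<alpha>})
                #>\<^bsub>general_linear_group scale\<^esub> inv\<^bsub>general_linear_group scale\<^esub> \<gamma>)"
proof -
  interpret F: finite_dimensional_vector_space scale Basis by fact
  have "finite (UNIV :: 'f set)"
    using assms(1,2) by (metis card.infinite not_prime_0)
  \<comment> \<open>A finite basis over a finite field spans a finite space, which places the
    problem in \<open>prime_field_space\<close>.\<close>
  then have "finite (F.span Basis)" by (rule F.finite_span[OF _ F.finite_Basis])
  then have "finite (UNIV :: 'v set)" by (simp add: F.span_Basis)
  then interpret prime_field_space scale p
    using assms(1,2) by unfold_locales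
  show ?thesis
    unfolding generate_GL[OF assms(6)] generate_GL[OF assms(7)] conj_coset_GL
    using rel_hol_iso_if_conjugate[OF assms(6,7)] conjugate_if_rel_hol_iso[OF assms(6,7)] by metis
qed

end
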